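(* Let $G$ and $H$ be controllable graphs. Then the following four conditions are equivalent: (1) $G$ and $H$ have the same iterated degree sequence; (2) $G$ and $H$ are fractionally isomorphic; (3) $G$ and $H$ are $C^2$-equivalent; (4) $G$ and $H$ are isomorphic.
   Context: All graphs are finite and simple. For a graph $G$ on $n$ vertices with adjacency matrix $A$, let $\mathbf{1}$ be the all-ones vector in $\mathbb{R}^n$. The walk matrix of $G$ is the $n\times n$ matrix $W_G=\big[\mathbf{1}\ \ A\mathbf{1}\ \cdots\ A^{n-1}\mathbf{1}\big]$. The graph $G$ is controllable if $W_G$ is invertible. Iterated degree sequence: for a vertex $v$ of $G$, let $d(v)$ be its degree and $N(v)$ the set of vertices adjacent to $v$. Define inductively $d_0(v)=d(v)$ and $d_{r+1}(v)=\{d_r(u): u\in N(v)\}$ (a multiset) for $r\ge 0$. Define $d_0(G)=\{d(v): v\in V(G)\}$ (a multiset) and $d_{r+1}(G)=\{d_r(v): v\in V(G)\}$ (a multiset) for $r\ge 0$. The iterated degree sequence of $G$ is the sequence $D(G)=(d_r(G))_{r\ge 0}$. Fractional isomorphism: a real square matrix is doubly stochastic if all its entries are non-negative and every row and every column sums to $1$. Graphs $G$ and $H$ with adjacency matrices $A$ and $B$ are fractionally isomorphic if there exists a doubly stochastic matrix $S$ such that $SA=BS$ (in particular $G$ and $H$ have the same number of vertices). $C^2$-equivalence: $C^2$ is the fragment of first-order logic with counting quantifiers, in the language of graphs, whose formulas use at most two distinct variables (each of which may be re-quantified). Formulas are built from atomic formulas $x=y$ and $Exy$ (adjacency), with variables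 ranging over vertices, using negation, disjunction (and the usual derived connectives), the quantifier $\exists$ (and the derived $\forall$), and for each non-negative integer $d$ the counting quantifier $\exists^{\ge d}$, where $\exists^{\ge d}x\,\phi$ holds in a graph if there are at least $d$ distinct vertices which can be substituted for $x$ to make $\phi$ true. A sentence is a formula without free variables. Two graphs $G$ and $H$ are $C^2$-equivalent if, for every $C^2$-sentence $\phi$, $G\models\phi$ if and only if $H\models\phi$. *)

theory Defs
  imports
    Complex_Main
    "HOL-Library.Multiset"
    "Jordan_Normal_Form.Matrix"
    "Graph_Theory.Pair_Digraph"
    "Graph_Theory.Digraph_Isomorphism"
begin

text \<open>
  A finite simple graph is a record \<open>G\<close> with \<open>pair_graph G\<close>: a finite vertex set \<open>pverts G\<close> and a
  symmetric, irreflexive adjacency relation \<open>parcs G\<close> on it.  The graph without vertices is allowed.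
\<close>

definition nbhd :: "'a pair_pre_digraph \<Rightarrow> 'a \<Rightarrow> 'a set" where
  "nbhd G v = {u \<in> pverts G. (v, u) \<in> parcs G}"

definition degree :: "'a pair_pre_digraph \<Rightarrow> 'a \<Rightarrow> nat" where
  "degree G v = card (nbhd G v)"

text \<open>
  Library isomorphism also carries a bijection between the arcs; on simple graphs this is no extra
  information.
\<close>

definition isomorphic :: "'a pair_pre_digraph \<Rightarrow> 'b pair_pre_digraph \<Rightarrow> bool" where
  "isomorphic G H \<longleftrightarrow> digraph_iso (with_proj G) (with_proj H)"

lemma isomorphic_iff:
  assumes "pair_graph G" "pair_graph H"
  shows "isomorphic G H \<longleftrightarrow>
    (\<exists>f. bij_betw f (pverts G) (pverts H) \<and>
         (\<forall>u\<in>pverts G. \<forall>v\<in>pverts G. (u, v) \<in> parcs G \<longleftrightarrow> (f u, f v) \<in> parcs H))"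
    (is "_ \<longleftrightarrow> (\<exists>f. ?P f)")
proof -
  interpret G: pair_graph G by fact
  interpret H: pair_graph H by fact
  show ?thesis
  proof
    assume "isomorphic G H"
    then obtain h where h: "pre_digraph.digraph_isomorphism (with_proj G) h"
      and H: "with_proj H = app_iso h (with_proj G)"
      by (auto simp: isomorphic_def digraph_iso_def)
    let ?f = "iso_verts h"
    have V: "pverts H = ?f ` pverts G" and E: "parcs H = iso_arcs h ` parcs G"
      and t: "iso_tail h = fst" and hd: "iso_head h = snd"
      using arg_cong[OF H, of verts] arg_cong[OF H, of arcs]
        arg_cong[OF H, of tail] arg_cong[OF H, of head]
      by simp_all
    have inj: "inj_on ?f (pverts G)"
      using h by (simp add: pre_digraph.digraph_isomorphism_def)
    have arc: "iso_arcs h (u, v) = (?f u, ?f v)" if "(u, v) \<in> parcs G" for u v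
    proof (rule prod_eqI)
      have "?f (tail (with_proj G) a) = iso_tail h (iso_arcs h a)"
        and "?f (head (with_proj G) a) = iso_head h (iso_arcs h a)" if "a \<in> arcs (with_proj G)" for a
        using h that unfolding pre_digraph.digraph_isomorphism_def by blast+
      from this[of "(u, v)"] that t hd
      show "fst (iso_arcs h (u, v)) = fst (?f u, ?f v)" "snd (iso_arcs h (u, v)) = snd (?f u, ?f v)"
        by simp_all
    qed
    have "(u, v) \<in> parcs G" if "u \<in> pverts G" "v \<in> pverts G" "(?f u, ?f v) \<in> parcs H" for u v
    proof -
      obtain a b where ab: "(a, b) \<in> parcs G" "iso_arcs h (a, b) = (?f u, ?f v)"
        using \<open>(?f u, ?f v) \<in> parcs H\<close> unfolding E by (smt (verit) imageE surj_pair)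
      moreover have "a \<in> pverts G" "b \<in> pverts G"
        using ab(1) G.in_arcsD1 G.in_arcsD2 by blast+
      ultimately have "a = u" "b = v"
        using arc[OF ab(1)] that by (auto intro: inj_onD[OF inj])
      with ab show ?thesis by simp
    qed
    moreover have "(?f u, ?f v) \<in> parcs H" if "(u, v) \<in> parcs G" for u v
      unfolding E arc[OF that, symmetric] using that by (rule imageI)
    ultimately have "?P ?f" using inj V unfolding bij_betw_def by blast
    then show "\<exists>f. ?P f" by blast
  next
    assume "\<exists>f. ?P f"
    then obtain f where f: "?P f" by blast
    then have inj: "inj_on f (pverts G)" and V: "pverts H = f ` pverts G"
      unfolding bij_betw_def by blast+
    define h where "h = \<lparr>iso_verts = f, iso_arcs = map_prod f f,
      iso_head = (snd :: 'b \<times> 'b \<Rightarrow> 'b), iso_tail = (fst :: 'b \<times> 'b \<Rightarrow> 'b)\<rparr>"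
    have E: "parcs H = map_prod f f ` parcs G"
    proof
      show "parcs H \<subseteq> map_prod f f ` parcs G"
      proof
        fix e assume e: "e \<in> parcs H"
        then obtain u v where uv: "u \<in> pverts G" "v \<in> pverts G" "fst e = f u" "snd e = f v"
          using H.arc_fst_in_verts H.arc_snd_in_verts unfolding V by blast
        then have "e = (f u, f v)" by (simp add: prod_eq_iff)
        with f uv e have "(u, v) \<in> parcs G" by blast
        with \<open>e = (f u, f v)\<close> show "e \<in> map_prod f f ` parcs G" by (metis image_eqI map_prod_simp)
      qed
      show "map_prod f f ` parcs G \<subseteq> parcs H"
      proof
        fix e assume "e \<in> map_prod f f ` parcs G"
        then obtain u v where "(u, v) \<in> parcs G" "e = (f u, f v)" by auto
        then show "e \<in> parcs H" using f G.in_arcsD1 G.in_arcsD2 by blast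
      qed
    qed
    have "inj_on (map_prod f f) (parcs G)"
    proof (rule inj_onI)
      fix d e assume "d \<in> parcs G" "e \<in> parcs G" "map_prod f f d = map_prod f f e"
      then show "d = e"
        using inj_onD[OF inj] G.arc_fst_in_verts G.arc_snd_in_verts
        by (metis fst_map_prod prod_eqI snd_map_prod)
    qed
    then have "pre_digraph.digraph_isomorphism (with_proj G) h"
      using inj G.wf_digraph
      by (simp add: pre_digraph.digraph_isomorphism_def h_def)
    moreover have "with_proj H = app_iso h (with_proj G)"
      using V E by (simp add: app_iso_def h_def with_proj_def)
    ultimately show "isomorphic G H" unfolding isomorphic_def digraph_iso_def by blast
  qed
qed

text \<open>
  Matrices are taken with respect to an arbitrary but fixed enumeration of the vertices; another
  enumeration conjugates the adjacency matrix by a permutation matrix and permutes the rows of the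
  walk matrix.
\<close>

definition vertex_list :: "'a pair_pre_digraph \<Rightarrow> 'a list" where
  "vertex_list G = (SOME vs. distinct vs \<and> set vs = pverts G)"

lemma vertex_list:
  assumes "finite (pverts G)"
  shows "distinct (vertex_list G)" "set (vertex_list G) = pverts G"
    "length (vertex_list G) = card (pverts G)"
proof -
  have "distinct (vertex_list G) \<and> set (vertex_list G) = pverts G"
    unfolding vertex_list_def using finite_distinct_list[OF assms] by (metis (mono_tags, lifting) someI_ex)
  then show "distinct (vertex_list G)" "set (vertex_list G) = pverts G"
    "length (vertex_list G) = card (pverts G)"
    using distinct_card[of "vertex_list G"] by simp_all
qed

definition adj_matrix :: "'a pair_pre_digraph \<Rightarrow> real mat" where
  "adj_matrix G = mat (card (pverts G)) (card (pverts G))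
     (\<lambda>(i, j). if (vertex_list G ! i, vertex_list G ! j) \<in> parcs G then 1 else 0)"

definition walk_matrix :: "'a pair_pre_digraph \<Rightarrow> real mat" where
  "walk_matrix G = (let n = card (pverts G) in
     mat_of_cols n (map (\<lambda>k. (adj_matrix G ^\<^sub>m k) *\<^sub>v vec n (\<lambda>_. 1)) [0..<n]))"

definition controllable :: "'a pair_pre_digraph \<Rightarrow> bool" where
  "controllable G \<longleftrightarrow> invertible_mat (walk_matrix G)"

text \<open>
  The iterated degree of a vertex at level \<open>r\<close> is a multiset nested \<open>r\<close> times over natural numbers.
  This datatype holds all levels at once and does not depend on the vertex type, so that iterated
  degrees of vertices of different graphs can be compared.
\<close>

datatype iter_degree = Deg nat | Nbrs "iter_degree multiset"

primrec vertex_iter_degree :: "'a pair_pre_digraph \<Rightarrow> nat \<Rightarrow> 'a \<Rightarrow> iter_degree" where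
  "vertex_iter_degree G 0 v = Deg (degree G v)"
| "vertex_iter_degree G (Suc r) v =
     Nbrs (image_mset (vertex_iter_degree G r) (mset_set (nbhd G v)))"

text \<open>
  The index shift in the second equation is intended: the entries at \<open>0\<close> and \<open>1\<close> coincide.
\<close>

primrec graph_iter_degree :: "'a pair_pre_digraph \<Rightarrow> nat \<Rightarrow> iter_degree multiset" where
  "graph_iter_degree G 0 = image_mset (\<lambda>v. Deg (degree G v)) (mset_set (pverts G))"
| "graph_iter_degree G (Suc r) = image_mset (vertex_iter_degree G r) (mset_set (pverts G))"

definition iterated_degree_sequence :: "'a pair_pre_digraph \<Rightarrow> nat \<Rightarrow> iter_degree multiset" where
  "iterated_degree_sequence G = (\<lambda>r. graph_iter_degree G r)"

definition doubly_stochastic :: "real mat \<Rightarrow> bool" where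
  "doubly_stochastic S \<longleftrightarrow> square_mat S \<and>
     (\<forall>i<dim_row S. \<forall>j<dim_col S. 0 \<le> S $$ (i, j)) \<and>
     (\<forall>i<dim_row S. (\<Sum>j<dim_col S. S $$ (i, j)) = 1) \<and>
     (\<forall>j<dim_col S. (\<Sum>i<dim_row S. S $$ (i, j)) = 1)"

text \<open>
  The carrier condition makes both products well-formed; with squareness of \<open>S\<close> it forces the two
  graphs to have equally many vertices.
\<close>

definition fractionally_isomorphic :: "'a pair_pre_digraph \<Rightarrow> 'b pair_pre_digraph \<Rightarrow> bool" where
  "fractionally_isomorphic G H \<longleftrightarrow>
     (\<exists>S \<in> carrier_mat (card (pverts H)) (card (pverts G)).
        doubly_stochastic S \<and> S * adj_matrix G = adj_matrix H * S)"

text \<open>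
  First-order formulas with counting quantifiers over the variables \<open>0, 1, 2, \<dots>\<close>;
  \<open>CExists d x \<phi>\<close> says that at least \<open>d\<close> vertices \<open>x\<close> satisfy \<open>\<phi>\<close>.
\<close>

datatype cformula =
    Equal nat nat
  | Adj nat nat
  | Neg cformula
  | Disj cformula cformula
  | Exists nat cformula
  | CExists nat nat cformula

primrec vars :: "cformula \<Rightarrow> nat set" where
  "vars (Equal x y) = {x, y}"
| "vars (Adj x y) = {x, y}"
| "vars (Neg \<phi>) = vars \<phi>"
| "vars (Disj \<phi> \<psi>) = vars \<phi> \<union> vars \<psi>"
| "vars (Exists x \<phi>) = insert x (vars \<phi>)"
| "vars (CExists d x \<phi>) = insert x (vars \<phi>)"

primrec free_vars :: "cformula \<Rightarrow> nat set" where
  "free_vars (Equal x y) = {x, y}"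
| "free_vars (Adj x y) = {x, y}"
| "free_vars (Neg \<phi>) = free_vars \<phi>"
| "free_vars (Disj \<phi> \<psi>) = free_vars \<phi> \<union> free_vars \<psi>"
| "free_vars (Exists x \<phi>) = free_vars \<phi> - {x}"
| "free_vars (CExists d x \<phi>) = free_vars \<phi> - {x}"

definition C2_sentence :: "cformula \<Rightarrow> bool" where
  "C2_sentence \<phi> \<longleftrightarrow> card (vars \<phi>) \<le> 2 \<and> free_vars \<phi> = {}"

primrec sat :: "'a pair_pre_digraph \<Rightarrow> (nat \<Rightarrow> 'a) \<Rightarrow> cformula \<Rightarrow> bool" where
  "sat G \<alpha> (Equal x y) \<longleftrightarrow> \<alpha> x = \<alpha> y"
| "sat G \<alpha> (Adj x y) \<longleftrightarrow> (\<alpha> x, \<alpha> y) \<in> parcs G"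
| "sat G \<alpha> (Neg \<phi>) \<longleftrightarrow> \<not> sat G \<alpha> \<phi>"
| "sat G \<alpha> (Disj \<phi> \<psi>) \<longleftrightarrow> sat G \<alpha> \<phi> \<or> sat G \<alpha> \<psi>"
| "sat G \<alpha> (Exists x \<phi>) \<longleftrightarrow> (\<exists>v\<in>pverts G. sat G (\<alpha>(x := v)) \<phi>)"
| "sat G \<alpha> (CExists d x \<phi>) \<longleftrightarrow> d \<le> card {v \<in> pverts G. sat G (\<alpha>(x := v)) \<phi>}"

text \<open>
  Only the values of the free variables matter, so the assignment is irrelevant for sentences.
  Assignments are not required to take values in \<open>pverts G\<close>: if there are no vertices, no
  such assignment exists, and every sentence would come out true.
\<close>

lemma sat_cong:
  "(\<And>x. x \<in> free_vars \<phi> \<Longrightarrow> \<alpha> x = \<beta> x) \<Longrightarrow> sat G \<alpha> \<phi> \<longleftrightarrow> sat G \<beta> \<phi>"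
proof (induction \<phi> arbitrary: \<alpha> \<beta>)
  case (Neg \<phi>)
  have "sat G \<alpha> \<phi> \<longleftrightarrow> sat G \<beta> \<phi>"
    by (rule Neg.IH) (simp add: Neg.prems)
  then show ?case by simp
next
  case (Disj \<phi> \<psi>)
  have "sat G \<alpha> \<phi> \<longleftrightarrow> sat G \<beta> \<phi>" by (rule Disj.IH(1)) (simp add: Disj.prems)
  moreover have "sat G \<alpha> \<psi> \<longleftrightarrow> sat G \<beta> \<psi>" by (rule Disj.IH(2)) (simp add: Disj.prems)
  ultimately show ?case by simp
next
  case (Exists x \<phi>)
  have "sat G (\<alpha>(x := v)) \<phi> \<longleftrightarrow> sat G (\<beta>(x := v)) \<phi>" for v
    by (rule Exists.IH) (simp add: Exists.prems)
  then show ?case by simp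
next
  case (CExists d x \<phi>)
  have "sat G (\<alpha>(x := v)) \<phi> \<longleftrightarrow> sat G (\<beta>(x := v)) \<phi>" for v
    by (rule CExists.IH) (simp add: CExists.prems)
  then show ?case by simp
qed simp_all

definition models :: "'a pair_pre_digraph \<Rightarrow> cformula \<Rightarrow> bool" where
  "models G \<phi> \<longleftrightarrow> (\<forall>\<alpha>. sat G \<alpha> \<phi>)"

lemma models_sentence: "free_vars \<phi> = {} \<Longrightarrow> models G \<phi> \<longleftrightarrow> sat G \<alpha> \<phi>"
  unfolding models_def using sat_cong[of \<phi>] by blast

definition C2_equivalent :: "'a pair_pre_digraph \<Rightarrow> 'b pair_pre_digraph \<Rightarrow> bool" where
  "C2_equivalent G H \<longleftrightarrow> (\<forall>\<phi>. C2_sentence \<phi> \<longrightarrow> (models G \<phi> \<longleftrightarrow> models H \<phi>))"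

end

theory Submission
  imports Defs
begin

text \<open>
  The number of walks of length \<open>k\<close> starting in a vertex is an entry of the walk matrix, and it can
  be read off the iterated degree of that vertex at any level \<open>r \<ge> k\<close>.  Controllability says that
  the rows of the walk matrix are linearly independent, so vertices are distinguished by their walk
  counts.  Hence equal iterated degree sequences give a bijection preserving walk counts, and
  comparing the neighbourhoods of corresponding vertices shows that it preserves adjacency.

  If \<open>S A = B S\<close> with \<open>S\<close> doubly stochastic, then \<open>S W\<^sub>G = W\<^sub>H\<close> and \<open>S\<^sup>T W\<^sub>H = W\<^sub>G\<close>, so
  \<open>S\<^sup>T S = I\<close>.  A non-negative matrix whose columns have entry sum \<open>1\<close> and Euclidean norm \<open>1\<close> has
  entries in \<open>{0, 1}\<close>; so \<open>S\<close> is a permutation matrix.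

  For fixed \<open>r\<close> and \<open>t\<close>, the statement that a vertex has iterated degree \<open>t\<close> at level \<open>r\<close> is
  expressed by a formula with two variables, which alternate their roles along \<open>r\<close>; prefixing it
  with counting quantifiers recovers the iterated degree sequence from the sentences.
\<close>

section \<open>Walk counts and controllability\<close>

primrec walks :: "'a pair_pre_digraph \<Rightarrow> nat \<Rightarrow> 'a \<Rightarrow> real" where
  "walks G 0 v = 1"
| "walks G (Suc k) v = (\<Sum>u\<in>nbhd G v. walks G k u)"

lemma nbhd_subset: "nbhd G v \<subseteq> pverts G"
  by (auto simp: nbhd_def)

lemma finite_nbhd: "finite (pverts G) \<Longrightarrow> finite (nbhd G v)"
  by (rule finite_subset[OF nbhd_subset])

lemma finite_pverts:
  assumes "pair_graph G"
  shows "finite (pverts G)"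
proof -
  interpret pair_graph G by fact
  show ?thesis by (rule pair_finite_verts)
qed

lemma parcs_sym:
  assumes "pair_graph G"
  shows "(u, v) \<in> parcs G \<longleftrightarrow> (v, u) \<in> parcs G"
proof -
  interpret pair_graph G by fact
  show ?thesis using sym_arcs by (auto simp: symmetric_def sym_def)
qed

lemma nbhd_sym:
  assumes "pair_graph G" "u \<in> pverts G" "v \<in> pverts G"
  shows "u \<in> nbhd G v \<longleftrightarrow> v \<in> nbhd G u"
  using assms(2,3) parcs_sym[OF assms(1), of u v] by (simp add: nbhd_def)

text \<open>With 0/1 weights the range of summation no longer depends on \<open>v\<close>. This
  matches entries of products with \<open>adj_matrix\<close> and allows double sums to be
  swapped.\<close>

lemma sum_nbhd:
  fixes h :: "'a \<Rightarrow> real"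
  assumes "finite (pverts G)"
  shows "(\<Sum>u\<in>nbhd G v. h u) = (\<Sum>u\<in>pverts G. (if (v, u) \<in> parcs G then 1 else 0) * h u)"
proof -
  have "(\<Sum>u\<in>nbhd G v. h u) = (\<Sum>u\<in>pverts G. if (v, u) \<in> parcs G then h u else 0)"
    unfolding nbhd_def by (rule sum.inter_filter[OF assms])
  also have "\<dots> = (\<Sum>u\<in>pverts G. (if (v, u) \<in> parcs G then 1 else 0) * h u)"
    by (rule sum.cong) simp_all
  finally show ?thesis .
qed

lemma sum_vertex_list:
  assumes "finite (pverts G)"
  shows "(\<Sum>j<card (pverts G). h (vertex_list G ! j)) = (\<Sum>v\<in>pverts G. h v)"
proof -
  note vl = vertex_list[OF assms]
  have "bij_betw ((!) (vertex_list G)) {..<card (pverts G)} (pverts G)"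
    using bij_betw_nth[OF vl(1) _ vl(2)[symmetric]] vl(3) by simp
  then show ?thesis by (rule sum.reindex_bij_betw)
qed

lemma vertex_list_nth_mem:
  "finite (pverts G) \<Longrightarrow> i < card (pverts G) \<Longrightarrow> vertex_list G ! i \<in> pverts G"
  using vertex_list nth_mem by metis

text \<open>The power is peeled on the right, so one factor acts on the vector first and raises
  \<open>m\<close> by one. The induction therefore runs for all \<open>m\<close>; the walk matrix is
  the case \<open>m = 0\<close>.\<close>

lemma adj_matrix_pow_walks:
  assumes "finite (pverts G)"
  defines "n \<equiv> card (pverts G)"
  shows "(adj_matrix G ^\<^sub>m k) *\<^sub>v vec n (\<lambda>i. walks G m (vertex_list G ! i))
    = vec n (\<lambda>i. walks G (k + m) (vertex_list G ! i))"
proof (induction k arbitrary: m)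
  case 0
  have "dim_row (adj_matrix G) = n" by (simp add: adj_matrix_def n_def)
  then show ?case by simp
next
  case (Suc k)
  have A: "adj_matrix G \<in> carrier_mat n n" by (simp add: adj_matrix_def n_def)
  have step: "adj_matrix G *\<^sub>v vec n (\<lambda>i. walks G m (vertex_list G ! i))
    = vec n (\<lambda>i. walks G (Suc m) (vertex_list G ! i))"
  proof (rule eq_vecI)
    fix i assume "i < dim_vec (vec n (\<lambda>i. walks G (Suc m) (vertex_list G ! i)))"
    then have i: "i < n" by simp
    have "(adj_matrix G *\<^sub>v vec n (\<lambda>i. walks G m (vertex_list G ! i))) $ i
      = (\<Sum>j<n. (if (vertex_list G ! i, vertex_list G ! j) \<in> parcs G then 1 else 0)
          * walks G m (vertex_list G ! j))"
      using i by (simp add: adj_matrix_def n_def scalar_prod_def atLeast0LessThan)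
    also have "\<dots> = walks G (Suc m) (vertex_list G ! i)"
      unfolding n_def sum_vertex_list[OF assms(1), where h = "\<lambda>u.
        (if (vertex_list G ! i, u) \<in> parcs G then 1 else 0) * walks G m u"]
      by (simp add: sum_nbhd[OF assms(1)])
    finally show "(adj_matrix G *\<^sub>v vec n (\<lambda>i. walks G m (vertex_list G ! i))) $ i
      = vec n (\<lambda>i. walks G (Suc m) (vertex_list G ! i)) $ i"
      using i by simp
  qed (simp add: adj_matrix_def n_def)
  have "(adj_matrix G ^\<^sub>m Suc k) *\<^sub>v vec n (\<lambda>i. walks G m (vertex_list G ! i))
    = (adj_matrix G ^\<^sub>m k) *\<^sub>v (adj_matrix G *\<^sub>v vec n (\<lambda>i. walks G m (vertex_list G ! i)))"
    using A by (simp add: assoc_mult_mat_vec[OF pow_carrier_mat[OF A] A])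
  then show ?case unfolding step using Suc.IH[of "Suc m"] by simp
qed

lemma walk_matrix_carrier: "walk_matrix G \<in> carrier_mat (card (pverts G)) (card (pverts G))"
  by (auto simp: walk_matrix_def Let_def)

lemma walk_matrix_index:
  assumes "finite (pverts G)" "i < card (pverts G)" "k < card (pverts G)"
  shows "walk_matrix G $$ (i, k) = walks G k (vertex_list G ! i)"
proof -
  define n where "n = card (pverts G)"
  have "walk_matrix G $$ (i, k) = ((adj_matrix G ^\<^sub>m k) *\<^sub>v vec n (\<lambda>_. 1)) $ i"
    using assms(2,3) by (simp add: walk_matrix_def Let_def mat_of_cols_index n_def)
  also have "vec n (\<lambda>_. 1) = vec n (\<lambda>i. walks G 0 (vertex_list G ! i))"
    by simp
  also have "(adj_matrix G ^\<^sub>m k) *\<^sub>v \<dots> = vec n (\<lambda>i. walks G (k + 0) (vertex_list G ! i))"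
    unfolding n_def by (rule adj_matrix_pow_walks[OF assms(1)])
  finally show ?thesis using assms(2) by (simp add: n_def)
qed

text \<open>The hypothesis says that the row vector \<open>c\<close> is annihilated by the walk
  matrix \<open>W\<close>. Multiplying by a right inverse of \<open>W\<close> gives back
  \<open>c\<close>, hence \<open>c = 0\<close>.\<close>

lemma controllable_independent:
  fixes c :: "'a \<Rightarrow> real"
  assumes "finite (pverts G)" "controllable G"
    and c: "\<And>k. k < card (pverts G) \<Longrightarrow> (\<Sum>u\<in>pverts G. c u * walks G k u) = 0"
    and v: "v \<in> pverts G"
  shows "c v = 0"
proof -
  define n where "n = card (pverts G)"
  define W where "W = walk_matrix G"
  have W: "W \<in> carrier_mat n n" unfolding W_def n_def by (rule walk_matrix_carrier)
  obtain B where B: "inverts_mat W B" "inverts_mat B W"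
    using assms(2) by (auto simp: controllable_def invertible_mat_def W_def)
  \<comment> \<open>\<open>inverts_mat\<close> leaves the shape of \<open>B\<close> open; counting
    columns in the two product identities forces it to be square of size \<open>n\<close>.\<close>
  have "dim_col (B * W) = dim_row B" "dim_col (W * B) = n"
    using B W by (simp_all add: inverts_mat_def)
  then have Bc: "B \<in> carrier_mat n n" using W by auto
  have WB: "W * B = 1\<^sub>m n" using B W by (simp add: inverts_mat_def)
  obtain i where i: "i < n" "v = vertex_list G ! i"
    using v vertex_list[OF assms(1)] unfolding n_def by (metis in_set_conv_nth)
  have Wc: "(\<Sum>j<n. c (vertex_list G ! j) * W $$ (j, k)) = 0" if "k < n" for k
    using sum_vertex_list[OF assms(1), of "\<lambda>u. c u * walks G k u"] c[of k] that
    by (simp add: W_def n_def walk_matrix_index[OF assms(1)])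
  have "c v = (\<Sum>j<n. c (vertex_list G ! j) * (1\<^sub>m n $$ (j, i)))"
    using i by (simp add: if_distrib cong: if_cong)
  also have "\<dots> = (\<Sum>j<n. c (vertex_list G ! j) * (\<Sum>k<n. W $$ (j, k) * B $$ (k, i)))"
    unfolding WB[symmetric] using W Bc i(1)
    by (intro sum.cong) (simp_all add: scalar_prod_def atLeast0LessThan)
  also have "\<dots> = (\<Sum>k<n. (\<Sum>j<n. c (vertex_list G ! j) * W $$ (j, k)) * B $$ (k, i))"
    unfolding sum_distrib_left sum_distrib_right by (subst sum.swap) (simp add: mult.assoc)
  also have "\<dots> = 0" using Wc by simp
  finally show ?thesis .
qed

text \<open>Otherwise the difference of the indicator functions of \<open>u\<close> and
  \<open>v\<close> would be a linear dependence between rows of the walk matrix.\<close>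

lemma controllable_walks_inj:
  assumes "finite (pverts G)" "controllable G" "u \<in> pverts G" "v \<in> pverts G"
    and "\<And>k. k < card (pverts G) \<Longrightarrow> walks G k u = walks G k v"
  shows "u = v"
proof (rule ccontr)
  assume "u \<noteq> v"
  define c :: "'a \<Rightarrow> real" where "c x = (if x = u then 1 else 0) - (if x = v then 1 else 0)" for x
  have "(\<Sum>x\<in>pverts G. c x * walks G k x) = 0" if "k < card (pverts G)" for k
    using assms that by (simp add: c_def left_diff_distrib sum_subtractf if_distrib[of "\<lambda>x. x * _"] cong: if_cong)
  then have "c u = 0" by (rule controllable_independent[OF assms(1,2) _ assms(3)])
  with \<open>u \<noteq> v\<close> show False by (simp add: c_def)
qed

section \<open>Iterated degrees\<close>

text \<open>Each nesting of multisets is one step of a walk. The value at \<open>Deg\<close> is a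
  dummy: at a level \<ge> \<open>k\<close> the length reaches 0 before a leaf has to be
  opened.\<close>

fun iter_degree_walks :: "nat \<Rightarrow> iter_degree \<Rightarrow> real" where
  "iter_degree_walks 0 t = 1"
| "iter_degree_walks (Suc k) (Nbrs M) = (\<Sum>t\<in>#M. iter_degree_walks k t)"
| "iter_degree_walks (Suc k) (Deg d) = 0"

lemma iter_degree_walks:
  "k \<le> r \<Longrightarrow> iter_degree_walks k (vertex_iter_degree G r v) = walks G k v"
proof (induction k arbitrary: r v)
  case (Suc k)
  then obtain r' where "r = Suc r'" "k \<le> r'" by (cases r) auto
  with Suc.IH show ?case by (simp add: multiset.map_comp comp_def sum_unfold_sum_mset)
qed simp

text \<open>Elements are matched one by one: some \<open>b\<close> has the same image as
  \<open>a\<close>, and the induction hypothesis applies after \<open>b\<close> is removed from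
  \<open>B\<close>.\<close>

lemma image_mset_mset_set_eq_bij:
  assumes "finite A" "finite B" "image_mset f (mset_set A) = image_mset g (mset_set B)"
  shows "\<exists>h. bij_betw h A B \<and> (\<forall>a\<in>A. g (h a) = f a)"
  using assms
proof (induction A arbitrary: B rule: finite_induct)
  case empty
  then have "B = {}" by (metis image_mset_is_empty_iff mset_set.empty mset_set_empty_iff)
  then show ?case by (auto simp: bij_betw_def)
next
  case (insert a A)
  have "image_mset g (mset_set B) = add_mset (f a) (image_mset f (mset_set A))"
    using insert.hyps insert.prems(2) by simp
  then have "f a \<in># image_mset g (mset_set B)" by simp
  then obtain b where b: "b \<in> B" "g b = f a" using insert.prems(1) by auto
  then have "mset_set B = add_mset b (mset_set (B - {b}))"
    using insert.prems(1) by (simp add: mset_set.remove)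
  then have "image_mset f (mset_set A) = image_mset g (mset_set (B - {b}))"
    using insert b by simp
  with insert.IH[of "B - {b}"] insert.prems(1) obtain h
    where h: "bij_betw h A (B - {b})" "\<forall>x\<in>A. g (h x) = f x" by auto
  have "bij_betw (h(a := b)) (insert a A) B"
  proof -
    have "bij_betw (h(a := b)) A (B - {b})"
      using h(1) insert.hyps(2) by (subst bij_betw_cong[where g = h]) auto
    then have "bij_betw (h(a := b)) (A \<union> {a}) ((B - {b}) \<union> {b})"
      by (rule bij_betw_combine) auto
    with b(1) show ?thesis by (simp add: insert_absorb)
  qed
  moreover have "\<forall>x\<in>insert a A. g ((h(a := b)) x) = f x" using h(2) b insert.hyps(2) by auto
  ultimately show ?case by blast
qed

text \<open>Corresponding vertices have neighbours with the same degrees one level below. In the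
  controllable graph \<open>H\<close>, a vertex with the same degree at that level as
  \<open>x\<close> can only be \<open>f x\<close>, so neighbourhoods are mapped to
  neighbourhoods.\<close>

lemma isomorphic_if_iterated_degree_sequence_eq:
  fixes G :: "'a pair_pre_digraph" and H :: "'b pair_pre_digraph"
  assumes G: "pair_graph G" and H: "pair_graph H" and "controllable H"
    and eq: "iterated_degree_sequence G = iterated_degree_sequence H"
  shows "isomorphic G H"
proof -
  note fin = finite_pverts[OF G] finite_pverts[OF H]
  \<comment> \<open>Walk lengths below \<open>card (pverts H)\<close> separate the vertices of
    \<open>H\<close>, so level \<open>r\<close> identifies a neighbour. The bijection is taken at
    level \<open>Suc r\<close>, where the neighbours' degrees at level \<open>r\<close> are
    visible.\<close>
  define r where "r = card (pverts H)"
  have "image_mset (vertex_iter_degree G (Suc r)) (mset_set (pverts G))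
    = image_mset (vertex_iter_degree H (Suc r)) (mset_set (pverts H))"
    \<comment> \<open>The sequence of the graph lags by one: its entry \<open>Suc (Suc r)\<close>
      collects the vertex degrees at level \<open>Suc r\<close>.\<close>
    using fun_cong[OF eq, of "Suc (Suc r)"]
    unfolding iterated_degree_sequence_def graph_iter_degree.simps .
  from image_mset_mset_set_eq_bij[OF fin this] obtain f where
    f: "bij_betw f (pverts G) (pverts H)" and
    d: "\<And>v. v \<in> pverts G \<Longrightarrow> vertex_iter_degree H (Suc r) (f v) = vertex_iter_degree G (Suc r) v"
    by blast
  have fV: "f v \<in> pverts H" if "v \<in> pverts G" for v
    using f that by (rule bij_betw_apply)
  have w: "walks H k (f v) = walks G k v" if "v \<in> pverts G" "k \<le> r" for v k
    using iter_degree_walks[of k "Suc r" H "f v"] iter_degree_walks[of k "Suc r" G v] that d by simp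
  have N: "u \<in> nbhd G v \<longleftrightarrow> f u \<in> nbhd H (f v)" if u: "u \<in> pverts G" and v: "v \<in> pverts G" for u v
  proof -
    have "image_mset (vertex_iter_degree G r) (mset_set (nbhd G v))
      = image_mset (vertex_iter_degree H r) (mset_set (nbhd H (f v)))"
      using d[OF v] by simp
    from arg_cong[OF this, of set_mset] have
      D: "vertex_iter_degree G r ` nbhd G v = vertex_iter_degree H r ` nbhd H (f v)"
      by (simp add: finite_nbhd fin)
    \<comment> \<open>\<open>f x\<close> has the walk counts of \<open>x\<close> by the choice of
      \<open>f\<close>, and \<open>x\<close> and \<open>y\<close> share theirs because both are
      decoded from the same degree.\<close>
    have match: "f x = y" if "x \<in> pverts G" "y \<in> pverts H"
      "vertex_iter_degree G r x = vertex_iter_degree H r y" for x y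
    proof (rule controllable_walks_inj[OF fin(2) \<open>controllable H\<close> fV[OF that(1)] that(2)])
      fix k assume "k < card (pverts H)"
      then have "k \<le> r" by (simp add: r_def)
      then show "walks H k (f x) = walks H k y"
        using w[OF that(1)] that(3) iter_degree_walks[of k r] by metis
    qed
    show ?thesis
    proof
      assume "u \<in> nbhd G v"
      then have "vertex_iter_degree G r u \<in> vertex_iter_degree H r ` nbhd H (f v)"
        unfolding D[symmetric] by (rule imageI)
      then obtain y where y: "vertex_iter_degree G r u = vertex_iter_degree H r y" "y \<in> nbhd H (f v)"
        by (rule imageE)
      moreover from y(2) have "y \<in> pverts H" by (rule subsetD[OF nbhd_subset])
      ultimately show "f u \<in> nbhd H (f v)" using match[OF u] by simp
    next
      assume "f u \<in> nbhd H (f v)"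
      then have "vertex_iter_degree H r (f u) \<in> vertex_iter_degree G r ` nbhd G v"
        unfolding D by (rule imageI)
      then obtain x where x: "vertex_iter_degree H r (f u) = vertex_iter_degree G r x" "x \<in> nbhd G v"
        by (rule imageE)
      from x(2) have "x \<in> pverts G" by (rule subsetD[OF nbhd_subset])
      with match[OF this fV[OF u] x(1)[symmetric]] u have "x = u"
        using bij_betw_imp_inj_on[OF f] by (simp add: inj_on_eq_iff)
      with x show "u \<in> nbhd G v" by simp
    qed
  qed
  have "\<forall>u\<in>pverts G. \<forall>v\<in>pverts G. (u, v) \<in> parcs G \<longleftrightarrow> (f u, f v) \<in> parcs H"
    using N fV unfolding nbhd_def by blast
  with f show ?thesis unfolding isomorphic_iff[OF G H] by blast
qed

section \<open>Fractional isomorphisms as functions on pairs of vertices\<close>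

text \<open>Rows belong to \<open>H\<close> and columns to \<open>G\<close>, as for \<open>S\<close>
  in \<open>S A = B S\<close>. With matrices given by functions on vertex pairs, later arguments do
  not see the enumerations.\<close>

definition vertex_mat :: "'b pair_pre_digraph \<Rightarrow> 'a pair_pre_digraph \<Rightarrow> ('b \<Rightarrow> 'a \<Rightarrow> real) \<Rightarrow> real mat" where
  "vertex_mat H G s = mat (card (pverts H)) (card (pverts G))
     (\<lambda>(i, j). s (vertex_list H ! i) (vertex_list G ! j))"

text \<open>The enumerations are injective and can be inverted, so quantifying over matrices of this
  shape amounts to quantifying over functions.\<close>

lemma vertex_mat_surj:
  assumes "finite (pverts G)" "finite (pverts H)"
    and "S \<in> carrier_mat (card (pverts H)) (card (pverts G))"
  shows "\<exists>s. S = vertex_mat H G s"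
proof -
  define p where "p = the_inv_into {..<card (pverts G)} ((!) (vertex_list G))"
  define q where "q = the_inv_into {..<card (pverts H)} ((!) (vertex_list H))"
  have "p (vertex_list G ! j) = j" if "j < card (pverts G)" for j
    unfolding p_def using that vertex_list[OF assms(1)]
    by (intro the_inv_into_f_f) (auto simp: inj_on_def nth_eq_iff_index_eq)
  moreover have "q (vertex_list H ! j) = j" if "j < card (pverts H)" for j
    unfolding q_def using that vertex_list[OF assms(2)]
    by (intro the_inv_into_f_f) (auto simp: inj_on_def nth_eq_iff_index_eq)
  ultimately have "S = vertex_mat H G (\<lambda>w v. S $$ (q w, p v))"
    using assms(3) by (intro eq_matI) (auto simp: vertex_mat_def)
  then show ?thesis by blast
qed

lemma all_vertex_list:
  assumes "finite (pverts G)"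
  shows "(\<forall>i<card (pverts G). P (vertex_list G ! i)) \<longleftrightarrow> (\<forall>v\<in>pverts G. P v)"
  using vertex_list[OF assms] by (metis in_set_conv_nth)

lemma vertex_mat_eq_iff:
  assumes "finite (pverts G)" "finite (pverts H)"
  shows "vertex_mat H G s = vertex_mat H G t \<longleftrightarrow> (\<forall>w\<in>pverts H. \<forall>v\<in>pverts G. s w v = t w v)"
proof -
  have "vertex_mat H G s = vertex_mat H G t \<longleftrightarrow> (\<forall>i<card (pverts H). \<forall>j<card (pverts G).
    s (vertex_list H ! i) (vertex_list G ! j) = t (vertex_list H ! i) (vertex_list G ! j))"
    by (auto simp: vertex_mat_def mat_eq_iff)
  also have "\<dots> \<longleftrightarrow> (\<forall>w\<in>pverts H. \<forall>v\<in>pverts G. s w v = t w v)"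
    by (simp add: all_vertex_list[OF assms(1), where P = "\<lambda>v. s _ v = t _ v"]
      all_vertex_list[OF assms(2), where P = "\<lambda>w. \<forall>v\<in>pverts G. s w v = t w v"])
  finally show ?thesis .
qed

lemma doubly_stochastic_vertex_mat:
  assumes "finite (pverts G)" "finite (pverts H)"
  shows "doubly_stochastic (vertex_mat H G s) \<longleftrightarrow> card (pverts G) = card (pverts H) \<and>
    (\<forall>w\<in>pverts H. \<forall>v\<in>pverts G. 0 \<le> s w v) \<and>
    (\<forall>w\<in>pverts H. (\<Sum>v\<in>pverts G. s w v) = 1) \<and>
    (\<forall>v\<in>pverts G. (\<Sum>w\<in>pverts H. s w v) = 1)"
proof -
  have row: "(\<Sum>j<card (pverts G). vertex_mat H G s $$ (i, j))
      = (\<Sum>v\<in>pverts G. s (vertex_list H ! i) v)" if "i < card (pverts H)" for i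
    using that by (subst sum_vertex_list[OF assms(1), symmetric]) (simp add: vertex_mat_def)
  have col: "(\<Sum>i<card (pverts H). vertex_mat H G s $$ (i, j))
      = (\<Sum>w\<in>pverts H. s w (vertex_list G ! j))" if "j < card (pverts G)" for j
    using that by (subst sum_vertex_list[OF assms(2), symmetric]) (simp add: vertex_mat_def)
  have nonneg: "(\<forall>i<card (pverts H). \<forall>j<card (pverts G). 0 \<le> vertex_mat H G s $$ (i, j))
    \<longleftrightarrow> (\<forall>w\<in>pverts H. \<forall>v\<in>pverts G. 0 \<le> s w v)"
    by (simp add: vertex_mat_def all_vertex_list[OF assms(1), where P = "\<lambda>v. 0 \<le> s _ v"]
      all_vertex_list[OF assms(2), where P = "\<lambda>w. \<forall>v\<in>pverts G. 0 \<le> s w v"])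
  have dim: "dim_row (vertex_mat H G s) = card (pverts H)"
    "dim_col (vertex_mat H G s) = card (pverts G)" by (simp_all add: vertex_mat_def)
  show ?thesis
    unfolding doubly_stochastic_def dim nonneg square_mat.simps
    by (auto simp: row col all_vertex_list[OF assms(1), where P = "\<lambda>v. (\<Sum>w\<in>pverts H. s w v) = 1"]
      all_vertex_list[OF assms(2), where P = "\<lambda>w. (\<Sum>v\<in>pverts G. s w v) = 1"])
qed

text \<open>Symmetry of adjacency turns the column of \<open>v\<close> in the adjacency matrix into
  the neighbourhood of \<open>v\<close>.\<close>

lemma vertex_mat_times_adj_matrix:
  assumes "pair_graph G"
  shows "vertex_mat H G s * adj_matrix G = vertex_mat H G (\<lambda>w v. \<Sum>u\<in>nbhd G v. s w u)"
proof (rule eq_matI)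
  note fin = finite_pverts[OF assms]
  fix i j assume "i < dim_row (vertex_mat H G (\<lambda>w v. \<Sum>u\<in>nbhd G v. s w u))"
    "j < dim_col (vertex_mat H G (\<lambda>w v. \<Sum>u\<in>nbhd G v. s w u))"
  then have ij: "i < card (pverts H)" "j < card (pverts G)" by (simp_all add: vertex_mat_def)
  have "(vertex_mat H G s * adj_matrix G) $$ (i, j)
    = (\<Sum>k<card (pverts G). (if (vertex_list G ! j, vertex_list G ! k) \<in> parcs G then 1 else 0)
        * s (vertex_list H ! i) (vertex_list G ! k))"
    using ij parcs_sym[OF assms, of "vertex_list G ! j"]
    by (simp add: vertex_mat_def adj_matrix_def scalar_prod_def atLeast0LessThan mult.commute)
  also have "\<dots> = (\<Sum>u\<in>nbhd G (vertex_list G ! j). s (vertex_list H ! i) u)"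
    unfolding sum_nbhd[OF fin] by (rule sum_vertex_list[OF fin])
  finally show "(vertex_mat H G s * adj_matrix G) $$ (i, j)
    = vertex_mat H G (\<lambda>w v. \<Sum>u\<in>nbhd G v. s w u) $$ (i, j)"
    using ij by (simp add: vertex_mat_def)
qed (simp_all add: vertex_mat_def adj_matrix_def)

lemma adj_matrix_times_vertex_mat:
  assumes "finite (pverts H)"
  shows "adj_matrix H * vertex_mat H G s = vertex_mat H G (\<lambda>w v. \<Sum>x\<in>nbhd H w. s x v)"
proof (rule eq_matI)
  fix i j assume "i < dim_row (vertex_mat H G (\<lambda>w v. \<Sum>x\<in>nbhd H w. s x v))"
    "j < dim_col (vertex_mat H G (\<lambda>w v. \<Sum>x\<in>nbhd H w. s x v))"
  then have ij: "i < card (pverts H)" "j < card (pverts G)" by (simp_all add: vertex_mat_def)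
  have "(adj_matrix H * vertex_mat H G s) $$ (i, j)
    = (\<Sum>k<card (pverts H). (if (vertex_list H ! i, vertex_list H ! k) \<in> parcs H then 1 else 0)
        * s (vertex_list H ! k) (vertex_list G ! j))"
    using ij by (simp add: vertex_mat_def adj_matrix_def scalar_prod_def atLeast0LessThan)
  also have "\<dots> = (\<Sum>x\<in>nbhd H (vertex_list H ! i). s x (vertex_list G ! j))"
    unfolding sum_nbhd[OF assms]
    by (rule sum_vertex_list[OF assms, where h = "\<lambda>x. _ x * s x (vertex_list G ! j)"])
  finally show "(adj_matrix H * vertex_mat H G s) $$ (i, j)
    = vertex_mat H G (\<lambda>w v. \<Sum>x\<in>nbhd H w. s x v) $$ (i, j)"
    using ij by (simp add: vertex_mat_def)
qed (simp_all add: vertex_mat_def adj_matrix_def)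

text \<open>The last conjunct is \<open>S A = B S\<close> read entrywise. Squareness is stated
  separately, as equality of the vertex counts in
  \<open>fractionally_isomorphic_iff\<close>.\<close>

definition fractional_isomorphism ::
  "'a pair_pre_digraph \<Rightarrow> 'b pair_pre_digraph \<Rightarrow> ('b \<Rightarrow> 'a \<Rightarrow> real) \<Rightarrow> bool" where
  "fractional_isomorphism G H s \<longleftrightarrow>
    (\<forall>w\<in>pverts H. \<forall>v\<in>pverts G. 0 \<le> s w v) \<and>
    (\<forall>w\<in>pverts H. (\<Sum>v\<in>pverts G. s w v) = 1) \<and>
    (\<forall>v\<in>pverts G. (\<Sum>w\<in>pverts H. s w v) = 1) \<and>
    (\<forall>w\<in>pverts H. \<forall>v\<in>pverts G. (\<Sum>u\<in>nbhd G v. s w u) = (\<Sum>x\<in>nbhd H w. s x v))"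

lemma fractionally_isomorphic_iff:
  assumes "pair_graph G" "pair_graph H"
  shows "fractionally_isomorphic G H \<longleftrightarrow> card (pverts G) = card (pverts H) \<and>
    (\<exists>s. fractional_isomorphism G H s)"
proof -
  note fin = finite_pverts[OF assms(1)] finite_pverts[OF assms(2)]
  have "fractionally_isomorphic G H \<longleftrightarrow> (\<exists>s. doubly_stochastic (vertex_mat H G s) \<and>
    vertex_mat H G s * adj_matrix G = adj_matrix H * vertex_mat H G s)"
    unfolding fractionally_isomorphic_def
    using vertex_mat_surj[OF fin] by (auto simp: vertex_mat_def)
  also have "\<dots> \<longleftrightarrow> (\<exists>s. card (pverts G) = card (pverts H) \<and> fractional_isomorphism G H s)"
    unfolding doubly_stochastic_vertex_mat[OF fin] vertex_mat_times_adj_matrix[OF assms(1)]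
      adj_matrix_times_vertex_mat[OF fin(2)] vertex_mat_eq_iff[OF fin] fractional_isomorphism_def
      conj_assoc ..
  finally show ?thesis by simp
qed

section \<open>Fractional isomorphisms and permutation matrices\<close>

lemma fractionally_isomorphic_if_isomorphic:
  assumes "pair_graph G" "pair_graph H" "isomorphic G H"
  shows "fractionally_isomorphic G H"
proof -
  note fin = finite_pverts[OF assms(1)] finite_pverts[OF assms(2)]
  obtain f where f: "bij_betw f (pverts G) (pverts H)"
    and E: "\<And>u v. u \<in> pverts G \<Longrightarrow> v \<in> pverts G \<Longrightarrow> (u, v) \<in> parcs G \<longleftrightarrow> (f u, f v) \<in> parcs H"
    using assms(3) unfolding isomorphic_iff[OF assms(1,2)] by blast
  \<comment> \<open>The permutation matrix of \<open>f\<close>.\<close>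
  define s :: "'b \<Rightarrow> 'a \<Rightarrow> real" where "s w v = (if f v = w then 1 else 0)" for w v
  have preim: "\<exists>v\<in>pverts G. f v = w" if "w \<in> pverts H" for w
    using bij_betw_imp_surj_on[OF f] that by (metis imageE)
  have inj: "f u = f v \<longleftrightarrow> u = v" if "u \<in> pverts G" "v \<in> pverts G" for u v
    using f that by (auto simp: bij_betw_def inj_on_def)
  have fV: "f v \<in> pverts H" if "v \<in> pverts G" for v
    using f that by (rule bij_betw_apply)
  have row: "(\<Sum>v\<in>pverts G. s w v) = 1" if w: "w \<in> pverts H" for w
  proof -
    obtain v where v: "v \<in> pverts G" "f v = w" using preim[OF w] by blast
    then have "(\<Sum>u\<in>pverts G. s w u) = (\<Sum>u\<in>pverts G. if u = v then 1 else 0)"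
      by (intro sum.cong) (auto simp: s_def inj)
    with v fin show ?thesis by simp
  qed
  have col: "(\<Sum>w\<in>pverts H. s w v) = 1" if "v \<in> pverts G" for v
    using fV[OF that] fin by (simp add: s_def)
  \<comment> \<open>Both sides are indicators. For \<open>w = f u\<close> the left one tests whether
    \<open>u\<close> is a neighbour of \<open>v\<close>, the right one whether \<open>f v\<close> is
    a neighbour of \<open>f u\<close>.\<close>
  have comm: "(\<Sum>u\<in>nbhd G v. s w u) = (\<Sum>x\<in>nbhd H w. s x v)"
    if w: "w \<in> pverts H" and v: "v \<in> pverts G" for w v
  proof -
    obtain u where u: "u \<in> pverts G" "w = f u" using preim[OF w] by blast
    have "(\<Sum>x\<in>nbhd G v. s w x) = (\<Sum>x\<in>nbhd G v. if x = u then 1 else 0)"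
      using u nbhd_subset[of G v] by (intro sum.cong) (auto simp: s_def inj)
    also have "\<dots> = (if u \<in> nbhd G v then 1 else 0)"
      by (simp add: finite_nbhd fin)
    also have "\<dots> = (if f v \<in> nbhd H w then 1 else 0)"
      using E[OF u(1) v] nbhd_sym[OF assms(1) u(1) v] u v fV by (simp add: nbhd_def)
    also have "\<dots> = (\<Sum>x\<in>nbhd H w. s x v)"
      by (simp add: s_def finite_nbhd fin)
    finally show ?thesis .
  qed
  have "\<forall>w\<in>pverts H. \<forall>v\<in>pverts G. 0 \<le> s w v" by (simp add: s_def)
  with row col comm have "fractional_isomorphism G H s"
    unfolding fractional_isomorphism_def by blast
  then show ?thesis
    unfolding fractionally_isomorphic_iff[OF assms(1,2)] using bij_betw_same_card[OF f] by blast
qed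

text \<open>In matrix form \<open>S A^k 1 = B^k 1\<close>: unit row sums give
  \<open>S 1 = 1\<close>, and each \<open>S A\<close> is replaced by \<open>B S\<close>. It serves
  for \<open>S\<close> and, through the column sums, for its transpose.\<close>

lemma walks_transport:
  assumes "pair_graph G" "finite (pverts H)"
    and row: "\<And>w. w \<in> pverts H \<Longrightarrow> (\<Sum>v\<in>pverts G. s w v) = 1"
    and comm: "\<And>w v. w \<in> pverts H \<Longrightarrow> v \<in> pverts G \<Longrightarrow>
      (\<Sum>u\<in>nbhd G v. s w u) = (\<Sum>x\<in>nbhd H w. s x v)"
    and "w \<in> pverts H"
  shows "(\<Sum>v\<in>pverts G. s w v * walks G k v) = walks H k w"
  using \<open>w \<in> pverts H\<close>
proof (induction k arbitrary: w)
  case 0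
  then show ?case using row by simp
next
  case (Suc k)
  note fin = finite_pverts[OF assms(1)]
  have "(\<Sum>v\<in>pverts G. s w v * walks G (Suc k) v)
    = (\<Sum>v\<in>pverts G. \<Sum>u\<in>pverts G. s w v * ((if (v, u) \<in> parcs G then 1 else 0) * walks G k u))"
    by (simp add: sum_nbhd[OF fin] sum_distrib_left)
  \<comment> \<open>Symmetry reverses the arc, so that after the swap the inner sum is the entry of
    \<open>S A\<close> at \<open>w\<close> and \<open>u\<close>.\<close>
  also have "\<dots> = (\<Sum>u\<in>pverts G. \<Sum>v\<in>pverts G. (if (u, v) \<in> parcs G then 1 else 0) * s w v * walks G k u)"
    using parcs_sym[OF assms(1)] by (subst sum.swap) (auto intro!: sum.cong)
  also have "\<dots> = (\<Sum>u\<in>pverts G. (\<Sum>v\<in>nbhd G u. s w v) * walks G k u)"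
    by (simp add: sum_nbhd[OF fin] sum_distrib_right)
  also have "\<dots> = (\<Sum>u\<in>pverts G. \<Sum>x\<in>nbhd H w. s x u * walks G k u)"
    using comm[OF Suc.prems] by (simp add: sum_distrib_right)
  also have "\<dots> = (\<Sum>x\<in>nbhd H w. \<Sum>u\<in>pverts G. s x u * walks G k u)"
    by (rule sum.swap)
  also have "\<dots> = (\<Sum>x\<in>nbhd H w. walks H k x)"
    using Suc.IH nbhd_subset[of H w] by (intro sum.cong) auto
  finally show ?case by simp
qed

lemma isomorphic_if_fractionally_isomorphic:
  assumes G: "pair_graph G" and H: "pair_graph H" and "controllable G"
    and "fractionally_isomorphic G H"
  shows "isomorphic G H"
proof -
  note fin = finite_pverts[OF G] finite_pverts[OF H]
  obtain s where "fractional_isomorphism G H s"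
    using assms(4) unfolding fractionally_isomorphic_iff[OF G H] by blast
  then have nonneg: "\<And>w v. w \<in> pverts H \<Longrightarrow> v \<in> pverts G \<Longrightarrow> 0 \<le> s w v"
    and row: "\<And>w. w \<in> pverts H \<Longrightarrow> (\<Sum>v\<in>pverts G. s w v) = 1"
    and col: "\<And>v. v \<in> pverts G \<Longrightarrow> (\<Sum>w\<in>pverts H. s w v) = 1"
    and comm: "\<And>w v. w \<in> pverts H \<Longrightarrow> v \<in> pverts G \<Longrightarrow>
      (\<Sum>u\<in>nbhd G v. s w u) = (\<Sum>x\<in>nbhd H w. s x v)"
    unfolding fractional_isomorphism_def by blast+
  have GH: "(\<Sum>v\<in>pverts G. s w v * walks G k v) = walks H k w" if "w \<in> pverts H" for w k
    by (rule walks_transport[OF G fin(2) row comm that])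
  have HG: "(\<Sum>w\<in>pverts H. s w v * walks H k w) = walks G k v" if "v \<in> pverts G" for v k
    by (rule walks_transport[OF H fin(1), where s = "\<lambda>v w. s w v"]) (simp_all add: col comm that)
  \<comment> \<open>The diagonal of \<open>S^T S = I\<close>. The function \<open>c\<close> is row
    \<open>v\<close> of \<open>S^T S - I\<close>; it annihilates the walk matrix of \<open>G\<close>
    because \<open>S\<close> carries the walk counts of \<open>G\<close> to those of
    \<open>H\<close> and \<open>S^T\<close> carries them back.\<close>
  have orth: "(\<Sum>w\<in>pverts H. s w v * s w v) = 1" if v: "v \<in> pverts G" for v
  proof -
    define c where "c u = (\<Sum>w\<in>pverts H. s w v * s w u) - (if u = v then 1 else 0)" for u
    have "c v = 0"
    proof (rule controllable_independent[OF fin(1) \<open>controllable G\<close> _ v])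
      fix k
      have "(\<Sum>u\<in>pverts G. (\<Sum>w\<in>pverts H. s w v * s w u) * walks G k u)
        = (\<Sum>w\<in>pverts H. s w v * (\<Sum>u\<in>pverts G. s w u * walks G k u))"
        unfolding sum_distrib_left sum_distrib_right by (subst sum.swap) (simp add: mult.assoc)
      also have "\<dots> = walks G k v" using GH HG[OF v] by simp
      finally show "(\<Sum>u\<in>pverts G. c u * walks G k u) = 0"
        using v fin by (simp add: c_def left_diff_distrib sum_subtractf if_distrib[of "\<lambda>x. x * _"] cong: if_cong)
    qed
    then show ?thesis by (simp add: c_def)
  qed
  \<comment> \<open>Entry sum and sum of squares of a column are both 1, so the non-negative terms
    \<open>s x v * (1 - s x v)\<close> sum to 0 and each of them vanishes.\<close>
  have zero_one: "s w v = 0 \<or> s w v = 1" if w: "w \<in> pverts H" and v: "v \<in> pverts G" for w v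
  proof -
    have "s x v \<le> 1" if "x \<in> pverts H" for x
      using member_le_sum[OF that, of "\<lambda>x. s x v"] nonneg v fin col by auto
    then have "0 \<le> s x v * (1 - s x v)" if "x \<in> pverts H" for x
      using nonneg v that by (simp add: mult_nonneg_nonneg)
    moreover have "(\<Sum>x\<in>pverts H. s x v * (1 - s x v)) = 0"
      using col[OF v] orth[OF v] by (simp add: right_diff_distrib sum_subtractf)
    ultimately have "s w v * (1 - s w v) = 0"
      using w fin by (simp add: sum_nonneg_eq_0_iff)
    then show ?thesis by simp
  qed
  have "\<exists>w\<in>pverts H. s w v = 1" if v: "v \<in> pverts G" for v
  proof (rule ccontr)
    assume "\<not> ?thesis"
    then have "(\<Sum>w\<in>pverts H. s w v) = 0" using zero_one v by (intro sum.neutral) blast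
    with col[OF v] show False by simp
  qed
  then obtain f where f: "\<And>v. v \<in> pverts G \<Longrightarrow> f v \<in> pverts H" "\<And>v. v \<in> pverts G \<Longrightarrow> s (f v) v = 1"
    by metis
  have col_unique: "w = f v" if v: "v \<in> pverts G" and w: "w \<in> pverts H" "s w v \<noteq> 0" for w v
  proof (rule ccontr)
    assume "w \<noteq> f v"
    then have "(\<Sum>x\<in>{w, f v}. s x v) = 2" using f v w zero_one by auto
    moreover have "(\<Sum>x\<in>{w, f v}. s x v) \<le> (\<Sum>x\<in>pverts H. s x v)"
      using f v w nonneg fin by (intro sum_mono2) auto
    ultimately show False using col[OF v] by simp
  qed
  have s_eq: "s w v = (if w = f v then 1 else 0)" if v: "v \<in> pverts G" and w: "w \<in> pverts H" for w v
    using col_unique[OF v w] f(2)[OF v] by (cases "w = f v") auto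
  have "inj_on f (pverts G)"
  proof (rule inj_onI, rule ccontr)
    fix u v assume uv: "u \<in> pverts G" "v \<in> pverts G" "f u = f v" "u \<noteq> v"
    have "s (f v) u = 1" using f(2)[OF uv(1)] unfolding uv(3) .
    then have "(\<Sum>x\<in>{u, v}. s (f v) x) = 2" using f(2)[OF uv(2)] uv(4) by simp
    moreover have "(\<Sum>x\<in>{u, v}. s (f v) x) \<le> (\<Sum>x\<in>pverts G. s (f v) x)"
      using uv(1,2) f(1) nonneg fin by (intro sum_mono2) auto
    ultimately show False using row[OF f(1)[OF uv(2)]] by simp
  qed
  moreover have "f ` pverts G = pverts H"
  proof
    show "f ` pverts G \<subseteq> pverts H" using f by blast
    show "pverts H \<subseteq> f ` pverts G"
    proof
      fix w assume w: "w \<in> pverts H"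
      with row have "\<exists>v\<in>pverts G. s w v \<noteq> 0" by (metis sum.neutral zero_neq_one)
      with col_unique w show "w \<in> f ` pverts G" by blast
    qed
  qed
  \<comment> \<open>Since \<open>s\<close> is now the permutation matrix of \<open>f\<close>, the
    identity \<open>comm\<close> at \<open>f u\<close> and \<open>v\<close> equates two indicators
    of adjacency.\<close>
  moreover have "(u, v) \<in> parcs G \<longleftrightarrow> (f u, f v) \<in> parcs H"
    if u: "u \<in> pverts G" and v: "v \<in> pverts G" for u v
  proof -
    have "(\<Sum>x\<in>nbhd G v. s (f u) x) = (\<Sum>x\<in>nbhd G v. if x = u then 1 else 0)"
      using nbhd_subset[of G v] u f \<open>inj_on f (pverts G)\<close>
      by (intro sum.cong) (auto simp: s_eq subset_iff dest: inj_onD)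
    moreover have "(\<Sum>x\<in>nbhd H (f u). s x v) = (\<Sum>x\<in>nbhd H (f u). if x = f v then 1 else 0)"
      using nbhd_subset[of H "f u"] v by (intro sum.cong) (auto simp: s_eq subset_iff)
    ultimately have "u \<in> nbhd G v \<longleftrightarrow> f v \<in> nbhd H (f u)"
      using comm[OF f(1)[OF u] v] by (simp add: finite_nbhd fin split: if_splits)
    then show ?thesis
      using u v f(1) nbhd_sym[OF G u v] by (simp add: nbhd_def)
  qed
  ultimately show ?thesis unfolding isomorphic_iff[OF G H] bij_betw_def by blast
qed

section \<open>Two-variable counting formulas\<close>

text \<open>Assignments are tied together only on free variables, since elsewhere they may leave the
  graph. Under a quantifier \<open>v\<close> is paired with \<open>f v\<close>, and bijectivity of
  \<open>f\<close> preserves the number of witnesses.\<close>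

lemma sat_isomorphism:
  assumes f: "bij_betw f (pverts G) (pverts H)"
    and E: "\<And>u v. u \<in> pverts G \<Longrightarrow> v \<in> pverts G \<Longrightarrow> (u, v) \<in> parcs G \<longleftrightarrow> (f u, f v) \<in> parcs H"
    and "\<And>x. x \<in> free_vars \<phi> \<Longrightarrow> \<alpha> x \<in> pverts G \<and> \<beta> x = f (\<alpha> x)"
  shows "sat G \<alpha> \<phi> \<longleftrightarrow> sat H \<beta> \<phi>"
  using assms(3)
proof (induction \<phi> arbitrary: \<alpha> \<beta>)
  case (Equal x y)
  then show ?case using f by (auto simp: bij_betw_def dest: inj_onD)
next
  case (Adj x y)
  then show ?case using E by simp
next
  case (Neg \<phi>)
  have "sat G \<alpha> \<phi> \<longleftrightarrow> sat H \<beta> \<phi>" by (rule Neg.IH) (simp add: Neg.prems)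
  then show ?case by simp
next
  case (Disj \<phi> \<psi>)
  have "sat G \<alpha> \<phi> \<longleftrightarrow> sat H \<beta> \<phi>" by (rule Disj.IH(1)) (simp add: Disj.prems)
  moreover have "sat G \<alpha> \<psi> \<longleftrightarrow> sat H \<beta> \<psi>" by (rule Disj.IH(2)) (simp add: Disj.prems)
  ultimately show ?case by simp
next
  case (Exists x \<phi>)
  have "sat G (\<alpha>(x := v)) \<phi> \<longleftrightarrow> sat H (\<beta>(x := f v)) \<phi>" if "v \<in> pverts G" for v
    by (rule Exists.IH) (use Exists.prems that in auto)
  then show ?case by (simp flip: bij_betw_imp_surj_on[OF f])
next
  case (CExists d x \<phi>)
  have *: "sat G (\<alpha>(x := v)) \<phi> \<longleftrightarrow> sat H (\<beta>(x := f v)) \<phi>" if "v \<in> pverts G" for v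
    by (rule CExists.IH) (use CExists.prems that in auto)
  have "bij_betw f {v \<in> pverts G. sat G (\<alpha>(x := v)) \<phi>} {w \<in> pverts H. sat H (\<beta>(x := w)) \<phi>}"
    using bij_betw_imp_inj_on[OF f] *
    by (auto simp: bij_betw_def inj_on_def simp flip: bij_betw_imp_surj_on[OF f])
  then show ?case by (simp add: bij_betw_same_card)
qed

lemma C2_equivalent_if_isomorphic:
  assumes "pair_graph G" "pair_graph H" "isomorphic G H"
  shows "C2_equivalent G H"
proof -
  obtain f where f: "bij_betw f (pverts G) (pverts H)"
    "\<And>u v. u \<in> pverts G \<Longrightarrow> v \<in> pverts G \<Longrightarrow> (u, v) \<in> parcs G \<longleftrightarrow> (f u, f v) \<in> parcs H"
    using assms(3) unfolding isomorphic_iff[OF assms(1,2)] by blast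
  have "models G \<phi> \<longleftrightarrow> models H \<phi>" if "C2_sentence \<phi>" for \<phi>
  proof -
    have "free_vars \<phi> = {}" using that by (simp add: C2_sentence_def)
    \<comment> \<open>A sentence has no free variables, so the condition on the assignments is
      vacuous and any two will do, even for graphs without vertices.\<close>
    then show ?thesis
      using sat_isomorphism[OF f, of \<phi> undefined undefined]
      by (simp add: models_sentence[where \<alpha> = undefined])
  qed
  then show ?thesis by (simp add: C2_equivalent_def)
qed

section \<open>Vertex properties definable with two variables\<close>

text \<open>
  Both graphs are carried along because \<open>P\<close> and \<open>Q\<close> have to be defined by the same formula; the
  variables of \<open>C\<^sup>2\<close> are \<open>0\<close> and \<open>1\<close>.
\<close>

definition C2_definable ::
  "'a pair_pre_digraph \<Rightarrow> 'b pair_pre_digraph \<Rightarrow> nat \<Rightarrow> ('a \<Rightarrow> bool) \<Rightarrow> ('b \<Rightarrow> bool) \<Rightarrow> bool" where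
  "C2_definable G H x P Q \<longleftrightarrow> (\<exists>\<phi>. vars \<phi> \<subseteq> {0, 1} \<and> free_vars \<phi> \<subseteq> {x} \<and>
     (\<forall>\<alpha>. \<alpha> x \<in> pverts G \<longrightarrow> sat G \<alpha> \<phi> = P (\<alpha> x)) \<and>
     (\<forall>\<alpha>. \<alpha> x \<in> pverts H \<longrightarrow> sat H \<alpha> \<phi> = Q (\<alpha> x)))"

lemma C2_definable_True:
  assumes "x \<in> {0, 1}"
  shows "C2_definable G H x (\<lambda>_. True) (\<lambda>_. True)"
  unfolding C2_definable_def using assms by (intro exI[of _ "Equal x x"]) auto

lemma C2_definable_Not:
  assumes "C2_definable G H x P Q"
  shows "C2_definable G H x (\<lambda>v. \<not> P v) (\<lambda>w. \<not> Q w)"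
proof -
  obtain \<phi> where "vars \<phi> \<subseteq> {0, 1}" "free_vars \<phi> \<subseteq> {x}"
     "\<forall>\<alpha>. \<alpha> x \<in> pverts G \<longrightarrow> sat G \<alpha> \<phi> = P (\<alpha> x)" "\<forall>\<alpha>. \<alpha> x \<in> pverts H \<longrightarrow> sat H \<alpha> \<phi> = Q (\<alpha> x)"
    using assms unfolding C2_definable_def by blast
  then show ?thesis unfolding C2_definable_def by (intro exI[of _ "Neg \<phi>"]) simp
qed

lemma C2_definable_disj:
  assumes "C2_definable G H x P Q" "C2_definable G H x P' Q'"
  shows "C2_definable G H x (\<lambda>v. P v \<or> P' v) (\<lambda>w. Q w \<or> Q' w)"
proof -
  obtain \<phi> where "vars \<phi> \<subseteq> {0, 1}" "free_vars \<phi> \<subseteq> {x}"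
     "\<forall>\<alpha>. \<alpha> x \<in> pverts G \<longrightarrow> sat G \<alpha> \<phi> = P (\<alpha> x)" "\<forall>\<alpha>. \<alpha> x \<in> pverts H \<longrightarrow> sat H \<alpha> \<phi> = Q (\<alpha> x)"
    using assms(1) unfolding C2_definable_def by blast
  moreover obtain \<psi> where "vars \<psi> \<subseteq> {0, 1}" "free_vars \<psi> \<subseteq> {x}"
     "\<forall>\<alpha>. \<alpha> x \<in> pverts G \<longrightarrow> sat G \<alpha> \<psi> = P' (\<alpha> x)" "\<forall>\<alpha>. \<alpha> x \<in> pverts H \<longrightarrow> sat H \<alpha> \<psi> = Q' (\<alpha> x)"
    using assms(2) unfolding C2_definable_def by blast
  ultimately show ?thesis unfolding C2_definable_def by (intro exI[of _ "Disj \<phi> \<psi>"]) simp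
qed

lemma C2_definable_conj:
  assumes "C2_definable G H x P Q" "C2_definable G H x P' Q'"
  shows "C2_definable G H x (\<lambda>v. P v \<and> P' v) (\<lambda>w. Q w \<and> Q' w)"
  using C2_definable_Not[OF C2_definable_disj[OF assms[THEN C2_definable_Not]]] by simp

lemma C2_definable_Ball:
  assumes "finite T" "x \<in> {0, 1}" "\<And>t. t \<in> T \<Longrightarrow> C2_definable G H x (P t) (Q t)"
  shows "C2_definable G H x (\<lambda>v. \<forall>t\<in>T. P t v) (\<lambda>w. \<forall>t\<in>T. Q t w)"
  using assms
proof (induction T rule: finite_induct)
  case empty
  then show ?case using C2_definable_True by simp
next
  case (insert t T)
  then show ?case
    using C2_definable_conj[of G H x "P t" "Q t" "\<lambda>v. \<forall>t\<in>T. P t v" "\<lambda>w. \<forall>t\<in>T. Q t w"] by simp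
qed

text \<open>Binding \<open>y\<close> turns a property of \<open>y\<close> into one of
  \<open>x\<close>. Inside the formula for \<open>y\<close> the variable \<open>x\<close> may be
  bound again, so no third variable is needed.\<close>

lemma C2_definable_nbhd_ge:
  assumes "x \<in> {0, 1}" "y \<in> {0, 1}" "x \<noteq> y" "C2_definable G H y P Q"
  shows "C2_definable G H x (\<lambda>v. d \<le> card {u \<in> nbhd G v. P u}) (\<lambda>w. d \<le> card {u \<in> nbhd H w. Q u})"
proof -
  obtain \<phi> where \<phi>: "vars \<phi> \<subseteq> {0, 1}" "free_vars \<phi> \<subseteq> {y}"
     "\<And>\<alpha>. \<alpha> y \<in> pverts G \<Longrightarrow> sat G \<alpha> \<phi> = P (\<alpha> y)" "\<And>\<alpha>. \<alpha> y \<in> pverts H \<Longrightarrow> sat H \<alpha> \<phi> = Q (\<alpha> y)"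
    using assms(4) unfolding C2_definable_def by blast
  \<comment> \<open>The De Morgan form of: at least \<open>d\<close> many \<open>y\<close> are
    adjacent to \<open>x\<close> and satisfy \<phi>.\<close>
  define \<psi> where "\<psi> = CExists d y (Neg (Disj (Neg (Adj x y)) (Neg \<phi>)))"
  have "{u \<in> pverts G. (\<alpha> x, u) \<in> parcs G \<and> sat G (\<alpha>(y := u)) \<phi>} = {u \<in> nbhd G (\<alpha> x). P u}" for \<alpha>
    using \<phi>(3) by (auto simp: nbhd_def)
  moreover have "{u \<in> pverts H. (\<alpha> x, u) \<in> parcs H \<and> sat H (\<alpha>(y := u)) \<phi>} = {u \<in> nbhd H (\<alpha> x). Q u}" for \<alpha>
    using \<phi>(4) by (auto simp: nbhd_def)
  ultimately show ?thesis
    unfolding C2_definable_def using \<phi>(1,2) assms(1-3)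
    by (intro exI[of _ \<psi>]) (auto simp: \<psi>_def)
qed

lemma C2_definable_nbhd_eq:
  assumes "x \<in> {0, 1}" "y \<in> {0, 1}" "x \<noteq> y" "C2_definable G H y P Q"
  shows "C2_definable G H x (\<lambda>v. card {u \<in> nbhd G v. P u} = d) (\<lambda>w. card {u \<in> nbhd H w. Q u} = d)"
proof -
  have eq: "n = d \<longleftrightarrow> d \<le> n \<and> \<not> Suc d \<le> n" for n by auto
  show ?thesis
    unfolding eq[of "card _"]
    by (intro C2_definable_conj C2_definable_Not C2_definable_nbhd_ge[OF assms])
qed

lemma count_image_mset_mset_set:
  "finite A \<Longrightarrow> count (image_mset f (mset_set A)) t = card {a \<in> A. f a = t}"
  by (simp add: count_image_mset' eq_commute[of t] flip: filter_mset_mset_set)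

text \<open>A formula can mention only finitely many \<open>t\<close>. Correct counts on the support
  of \<open>M\<close> make \<open>M\<close> a submultiset of the image, and equal sizes exclude
  further elements.\<close>

lemma image_mset_mset_set_eq_iff:
  assumes "finite A"
  shows "image_mset f (mset_set A) = M \<longleftrightarrow>
    card A = size M \<and> (\<forall>t\<in>set_mset M. card {a \<in> A. f a = t} = count M t)"
proof -
  have c: "count (image_mset f (mset_set A)) t = card {a \<in> A. f a = t}" for t
    using assms by (rule count_image_mset_mset_set)
  show ?thesis
  proof
    assume "image_mset f (mset_set A) = M"
    then show "card A = size M \<and> (\<forall>t\<in>set_mset M. card {a \<in> A. f a = t} = count M t)"
      using c by (metis size_image_mset size_mset_set)
  next
    assume *: "card A = size M \<and> (\<forall>t\<in>set_mset M. card {a \<in> A. f a = t} = count M t)"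
    then have "M \<subseteq># image_mset f (mset_set A)"
      by (intro mset_subset_eqI) (metis c count_eq_zero_iff le_refl le0)
    then obtain N where "image_mset f (mset_set A) = M + N"
      by (auto simp: mset_subset_eq_exists_conv)
    moreover from this have "size M + size N = card A"
      using size_image_mset[of f "mset_set A"] by simp
    ultimately show "image_mset f (mset_set A) = M" using * by simp
  qed
qed

text \<open>Level \<open>Suc r\<close> at \<open>x\<close> is expressed through level
  \<open>r\<close> at the other variable, so the induction leaves \<open>x\<close> arbitrary and the
  two variables alternate.\<close>

lemma C2_definable_vertex_iter_degree:
  assumes fin: "finite (pverts G)" "finite (pverts H)"
  shows "x \<in> {0, 1} \<Longrightarrow>
    C2_definable G H x (\<lambda>v. vertex_iter_degree G r v = t) (\<lambda>w. vertex_iter_degree H r w = t)"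
proof (induction r arbitrary: x t)
  case 0
  \<comment> \<open>The other one of the variables 0 and 1.\<close>
  define y where "y = 1 - x"
  have y: "y \<in> {0, 1}" "x \<noteq> y" using 0 by (auto simp: y_def)
  show ?case
  proof (cases t)
    case (Deg d)
    then show ?thesis
      using C2_definable_nbhd_eq[OF 0 y C2_definable_True[OF y(1)], of G H d]
      by (simp add: degree_def)
  next
    \<comment> \<open>At level 0 no vertex has such a degree, so the property is the constant
      falsehood.\<close>
    case (Nbrs M)
    then show ?thesis using C2_definable_Not[OF C2_definable_True[OF 0], of G H] by simp
  qed
next
  case (Suc r)
  define y where "y = 1 - x"
  have y: "y \<in> {0, 1}" "x \<noteq> y" using Suc.prems by (auto simp: y_def)
  show ?case
  proof (cases t)
    case (Deg d)
    then show ?thesis using C2_definable_Not[OF C2_definable_True[OF Suc.prems], of G H] by simp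
  next
    case (Nbrs M)
    \<comment> \<open>The first conjunct fixes the degree; the trivial condition \<open>True\<close>
      makes it an instance of \<open>C2_definable_nbhd_eq\<close>.\<close>
    have "C2_definable G H x
      (\<lambda>v. card {u \<in> nbhd G v. True} = size M \<and>
        (\<forall>t\<in>set_mset M. card {u \<in> nbhd G v. vertex_iter_degree G r u = t} = count M t))
      (\<lambda>w. card {u \<in> nbhd H w. True} = size M \<and>
        (\<forall>t\<in>set_mset M. card {u \<in> nbhd H w. vertex_iter_degree H r u = t} = count M t))"
      by (intro C2_definable_conj C2_definable_Ball C2_definable_nbhd_eq[OF Suc.prems y]
        C2_definable_True Suc.IH y finite_set_mset Suc.prems)
    then show ?thesis
      by (simp add: Nbrs image_mset_mset_set_eq_iff finite_nbhd fin)
  qed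
qed

text \<open>For each \<open>d\<close> one sentence says that \<open>d\<close> is a lower bound of
  the cardinality, and a natural number is determined by its lower bounds.\<close>

lemma C2_equivalent_card_eq:
  assumes "C2_equivalent G H" "C2_definable G H 0 P Q"
  shows "card {v \<in> pverts G. P v} = card {w \<in> pverts H. Q w}"
proof -
  obtain \<phi> where \<phi>: "vars \<phi> \<subseteq> {0, 1}" "free_vars \<phi> \<subseteq> {0}"
     "\<And>\<alpha>. \<alpha> 0 \<in> pverts G \<Longrightarrow> sat G \<alpha> \<phi> = P (\<alpha> 0)" "\<And>\<alpha>. \<alpha> 0 \<in> pverts H \<Longrightarrow> sat H \<alpha> \<phi> = Q (\<alpha> 0)"
    using assms(2) unfolding C2_definable_def by blast
  have "d \<le> card {v \<in> pverts G. P v} \<longleftrightarrow> d \<le> card {w \<in> pverts H. Q w}" for d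
  proof -
    define \<psi> where "\<psi> = CExists d 0 \<phi>"
    have "vars \<psi> \<subseteq> {0, 1}" using \<phi>(1) by (simp add: \<psi>_def)
    then have "card (vars \<psi>) \<le> card {0, 1 :: nat}" by (intro card_mono) auto
    moreover have "free_vars \<psi> = {}" using \<phi>(2) by (auto simp: \<psi>_def)
    ultimately have "models G \<psi> \<longleftrightarrow> models H \<psi>"
      using assms(1) by (simp add: C2_equivalent_def C2_sentence_def)
    moreover have "{v \<in> pverts G. sat G (\<alpha>(0 := v)) \<phi>} = {v \<in> pverts G. P v}" for \<alpha>
      using \<phi>(3) by auto
    moreover have "{w \<in> pverts H. sat H (\<alpha>(0 := w)) \<phi>} = {w \<in> pverts H. Q w}" for \<alpha>
      using \<phi>(4) by auto
    ultimately show ?thesis by (simp add: models_def \<psi>_def)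
  qed
  then show ?thesis by (metis le_antisym order_refl)
qed

lemma vertex_iter_degree_0: "vertex_iter_degree G 0 = (\<lambda>v. Deg (degree G v))"
  by (simp add: fun_eq_iff)

text \<open>The multiplicity of \<open>t\<close> at a level is the cardinality of a definable set of
  vertices, hence the same in both graphs.\<close>

lemma iterated_degree_sequence_eq_if_C2_equivalent:
  assumes fin: "finite (pverts G)" "finite (pverts H)" and "C2_equivalent G H"
  shows "iterated_degree_sequence G = iterated_degree_sequence H"
proof -
  have level: "image_mset (vertex_iter_degree G r) (mset_set (pverts G))
    = image_mset (vertex_iter_degree H r) (mset_set (pverts H))" for r
  proof (rule multiset_eqI)
    fix t
    have "card {v \<in> pverts G. vertex_iter_degree G r v = t}
      = card {w \<in> pverts H. vertex_iter_degree H r w = t}"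
      by (intro C2_equivalent_card_eq[OF assms(3)] C2_definable_vertex_iter_degree fin) simp
    then show "count (image_mset (vertex_iter_degree G r) (mset_set (pverts G))) t
      = count (image_mset (vertex_iter_degree H r) (mset_set (pverts H))) t"
      using fin by (simp add: count_image_mset_mset_set)
  qed
  \<comment> \<open>Entries 0 and 1 of the sequence both come from vertex level 0, whence the
    separate use of \<open>level[of 0]\<close>.\<close>
  have "graph_iter_degree G r = graph_iter_degree H r" for r
    using level[of 0] level by (cases r) (simp_all add: vertex_iter_degree_0)
  then show ?thesis by (simp add: iterated_degree_sequence_def fun_eq_iff)
qed

theorem corollary7:
  fixes G :: "'a pair_pre_digraph" and H :: "'b pair_pre_digraph"
  assumes "pair_graph G" and "pair_graph H"
    and "controllable G" and "controllable H"
  shows "(iterated_degree_sequence G = iterated_degree_sequence H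
            \<longleftrightarrow> fractionally_isomorphic G H)
       \<and> (fractionally_isomorphic G H \<longleftrightarrow> C2_equivalent G H)
       \<and> (C2_equivalent G H \<longleftrightarrow> isomorphic G H)"
  using isomorphic_if_iterated_degree_sequence_eq[OF assms(1,2,4)]
    isomorphic_if_fractionally_isomorphic[OF assms(1-3)]
    iterated_degree_sequence_eq_if_C2_equivalent[OF finite_pverts[OF assms(1)] finite_pverts[OF assms(2)]]
    fractionally_isomorphic_if_isomorphic[OF assms(1,2)] C2_equivalent_if_isomorphic[OF assms(1,2)]
  by blast

end
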